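(* Let $N\ge 2$, let $\alpha\in(0,1)$, and let $\Psi:\mathbb{R}^{N-1}\to\mathbb{R}$ be $L$-Lipschitz, i.e. $|\Psi(x)-\Psi(y)|\le L|x-y|$ for all $x,y\in\mathbb{R}^{N-1}$. Let $$E_\Psi=\{x=(x',x_N)\in\mathbb{R}^N : x'\in\mathbb{R}^{N-1},\ x_N>\Psi(x')\}.$$ Let $U:E_\Psi\to\mathbb{R}$ be a bounded harmonic function for which there exists a constant $C$ such that $$|U(x',x_N)-U(x',y_N)|\le C|x_N-y_N|^\alpha\quad\text{for all } x'\in\mathbb{R}^{N-1} \text{ and all } x_N,y_N>\Psi(x').$$ Then there are constants $C_1$, $C_2$, $C_3$ such that $$\left|\frac{\partial U}{\partial x_N}(x)\right|\le C_1\, d(x,\partial E_\Psi)^{\alpha-1}\quad\text{and}\quad |\nabla U(x)|\le C_2\, d(x,\partial E_\Psi)^{\alpha-1}\quad\text{for all } x\in E_\Psi,$$ and $$|U(x)-U(y)|\le C_3|x-y|^\alpha\quad\text{for all } x,y\in E_\Psi.$$ In particular, $U$ has a continuous extension to the epigraph $\{(x',x_N): x'\in\mathbb{R}^{N-1},\ x_N\ge\Psi(x')\}$ of $\Psi$. Moreover, the constants $C_1,C_2,C_3$ depend linearly on $C$: one may take $C_i=c_i C$ for $i=1,2,3$, where $c_1,c_2,c_3$ do not depend on $U$ or on $C$ (they may depend on $N$, $\alpha$ and $\Psi$).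
   Context: $|\cdot|$ is the Euclidean norm, and $d(x,\partial E_\Psi)=\inf\{|x-p| : p\in\partial E_\Psi\}$ is the Euclidean distance from $x$ to the topological boundary of $E_\Psi$. Points of $\mathbb{R}^N$ are written $x=(x',x_N)$ with $x'\in\mathbb{R}^{N-1}$ and $x_N\in\mathbb{R}$. *)

theory Defs
  imports "HOL-Analysis.Analysis"
begin

definition partial_deriv :: "'a::euclidean_space \<Rightarrow> ('a \<Rightarrow> real) \<Rightarrow> 'a \<Rightarrow> real" where
  "partial_deriv b f x = deriv (\<lambda>t. f (x + t *\<^sub>R b)) 0"

definition grad :: "('a::euclidean_space \<Rightarrow> real) \<Rightarrow> 'a \<Rightarrow> 'a" where
  "grad f x = (\<Sum>b\<in>Basis. partial_deriv b f x *\<^sub>R b)"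

definition laplacian :: "('a::euclidean_space \<Rightarrow> real) \<Rightarrow> 'a \<Rightarrow> real" where
  "laplacian f x = (\<Sum>b\<in>Basis. partial_deriv b (partial_deriv b f) x)"

text \<open>The following two notions are meant for open sets \<open>S\<close>. The differentiability conditions
  guarantee that the partial derivatives occurring in them exist, since \<^const>\<open>deriv\<close> is total.\<close>

definition C2_on :: "('a::euclidean_space \<Rightarrow> real) \<Rightarrow> 'a set \<Rightarrow> bool" where
  "C2_on f S \<longleftrightarrow>
     (\<forall>x\<in>S. f differentiable (at x)) \<and>
     (\<forall>b\<in>Basis. \<forall>x\<in>S. partial_deriv b f differentiable (at x)) \<and>
     (\<forall>b\<in>Basis. \<forall>c\<in>Basis. continuous_on S (partial_deriv c (partial_deriv b f)))"

definition harmonic_on :: "('a::euclidean_space \<Rightarrow> real) \<Rightarrow> 'a set \<Rightarrow> bool" where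
  "harmonic_on f S \<longleftrightarrow> C2_on f S \<and> (\<forall>x\<in>S. laplacian f x = 0)"

text \<open>The space \<open>\<real>\<^sup>N\<close> with \<open>N \<ge> 2\<close> is represented as \<open>(real ^ 'm) \<times> real\<close> with
  \<open>N = CARD('m) + 1\<close>; the norm of this product type is the Euclidean one, and its basis vector
  \<open>(0, 1)\<close> is the direction of the last coordinate.\<close>

definition strict_epigraph :: "(real ^ 'm \<Rightarrow> real) \<Rightarrow> ((real ^ 'm) \<times> real) set" where
  "strict_epigraph \<Psi> = {(x', t). \<Psi> x' < t}"

definition closed_epigraph :: "(real ^ 'm \<Rightarrow> real) \<Rightarrow> ((real ^ 'm) \<times> real) set" where
  "closed_epigraph \<Psi> = {(x', t). \<Psi> x' \<le> t}"

end

theory Submission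
  imports Defs
begin

text \<open>
  Let $N$ be the dimension, $K = 1 + |L|$, and write $h(x) = x_N - \<Psi>(x')$ for the vertical
  height of $x$ above the graph. The graph is Lipschitz, so $h$ is $K$-Lipschitz and the ball of
  radius $h(x)/(2K)$ about $x$ stays in the epigraph; the distance of $x$ to the boundary is at
  most $h(x)$. Since $\<alpha> < 1$, it is enough to bound derivatives by multiples of
  $h(x)^{\<alpha>-1}$.

  The only fact about harmonic functions needed is the interior gradient estimate
  $|\<partial>_b u(x)| \<le> N \sup |u| / \<rho>$ on a ball of radius $\<rho>$
  (\<open>interior_gradient_estimate\<close>). It follows from the maximum principle alone: subtract from
  $u$ its mirror image in the hyperplane through $x$ orthogonal to $b$, and compare the difference,
  which vanishes on that hyperplane, with an explicit harmonic quadratic polynomial on a half ball.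

  For $s > 0$ the vertical difference $w(y) = U(y + s e_N) - U(y)$ is harmonic in the epigraph and,
  by the hypothesis, $|w| \<le> C s^\<alpha>$. The gradient estimate at $y$ with $s = h(y)$ gives, for
  every coordinate direction $b$,
  \[ |\<partial>_b U(y + h(y) e_N) - \<partial>_b U(y)| \<le> 2 K N C\, h(y)^{\<alpha>-1}. \]
  Moving up from $x$ in this way doubles the height at each step, so the right-hand sides form a
  geometric series of ratio $2^{\<alpha>-1} < 1$, while $\<partial>_b U$ tends to $0$ along the way
  because $U$ is bounded. Summing gives $|\<partial>_b U(x)| \<le> c\,C\,h(x)^{\<alpha>-1}$ for all
  directions at once (\<open>partial_deriv_bound_from_vertical_holder\<close>).

  For the Hoelder bound, raise both points by $2K|x-y|$. The vertical moves are controlled by the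
  hypothesis, and the segment between the raised points has height at least $|x-y|$, so there the
  gradient is at most a multiple of $C|x-y|^{\<alpha>-1}$ (\<open>holder_from_vertical_holder\<close>).
  A continuous extension exists because $U$ is then uniformly continuous.
\<close>

section \<open>Pointwise Laplacians\<close>

text \<open>These predicates ask for derivatives at and near a single point only, so they pass directly to
  sums, translates and mirror images, with no continuity of second derivatives to carry along.\<close>

definition has_second_deriv_along :: "('a::real_normed_vector \<Rightarrow> real) \<Rightarrow> 'a \<Rightarrow> 'a \<Rightarrow> real \<Rightarrow> bool" where
  "has_second_deriv_along f b x s \<longleftrightarrow>
     (\<exists>g. (\<forall>\<^sub>F t in nhds 0. ((\<lambda>t. f (x + t *\<^sub>R b)) has_real_derivative g t) (at t)) \<and>
          (g has_real_derivative s) (at 0))"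

definition has_laplacian :: "('a::euclidean_space \<Rightarrow> real) \<Rightarrow> 'a \<Rightarrow> real \<Rightarrow> bool" where
  "has_laplacian f x l \<longleftrightarrow>
     (\<exists>s. (\<forall>b\<in>Basis. has_second_deriv_along f b x (s b)) \<and> (\<Sum>b\<in>Basis. s b) = l)"

lemma has_second_deriv_along_add:
  assumes "has_second_deriv_along f b x s" "has_second_deriv_along g b x t"
  shows "has_second_deriv_along (\<lambda>y. f y + g y) b x (s + t)"
proof -
  obtain f' where f: "\<forall>\<^sub>F t in nhds 0. ((\<lambda>t. f (x + t *\<^sub>R b)) has_real_derivative f' t) (at t)"
      "(f' has_real_derivative s) (at 0)"
    using assms(1) unfolding has_second_deriv_along_def by blast
  obtain g' where g: "\<forall>\<^sub>F t in nhds 0. ((\<lambda>t. g (x + t *\<^sub>R b)) has_real_derivative g' t) (at t)"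
      "(g' has_real_derivative t) (at 0)"
    using assms(2) unfolding has_second_deriv_along_def by blast
  have "\<forall>\<^sub>F t in nhds 0.
      ((\<lambda>t. f (x + t *\<^sub>R b) + g (x + t *\<^sub>R b)) has_real_derivative f' t + g' t) (at t)"
    using f(1) g(1) by eventually_elim (rule DERIV_add)
  moreover have "((\<lambda>t. f' t + g' t) has_real_derivative s + t) (at 0)"
    using f(2) g(2) by (rule DERIV_add)
  ultimately show ?thesis
    unfolding has_second_deriv_along_def by (intro exI conjI)
qed

lemma has_second_deriv_along_cmult:
  assumes "has_second_deriv_along f b x s"
  shows "has_second_deriv_along (\<lambda>y. k * f y) b x (k * s)"
proof -
  obtain f' where f: "\<forall>\<^sub>F t in nhds 0. ((\<lambda>t. f (x + t *\<^sub>R b)) has_real_derivative f' t) (at t)"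
      "(f' has_real_derivative s) (at 0)"
    using assms(1) unfolding has_second_deriv_along_def by blast
  have "\<forall>\<^sub>F t in nhds 0.
      ((\<lambda>t. k * f (x + t *\<^sub>R b)) has_real_derivative k * f' t) (at t)"
    using f(1) by eventually_elim (rule DERIV_cmult)
  moreover have "((\<lambda>t. k * f' t) has_real_derivative k * s) (at 0)"
    using f(2) by (rule DERIV_cmult)
  ultimately show ?thesis
    unfolding has_second_deriv_along_def by (intro exI conjI)
qed

lemma has_second_deriv_along_minus_direction:
  assumes "has_second_deriv_along f b x s"
  shows "has_second_deriv_along f (- b) x s"
proof -
  obtain f' where f: "\<forall>\<^sub>F t in nhds 0. ((\<lambda>t. f (x + t *\<^sub>R b)) has_real_derivative f' t) (at t)"
      "(f' has_real_derivative s) (at 0)"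
    using assms(1) unfolding has_second_deriv_along_def by blast
  have "filterlim (\<lambda>t::real. - t) (nhds 0) (nhds 0)"
    using tendsto_minus[OF filterlim_ident, of "0::real"] by simp
  from eventually_compose_filterlim[OF f(1) this]
  have "\<forall>\<^sub>F t in nhds 0. ((\<lambda>t. f (x + t *\<^sub>R b)) has_real_derivative f' (- t)) (at (- t))" .
  hence "\<forall>\<^sub>F t in nhds 0.
      ((\<lambda>t. f (x + t *\<^sub>R (- b))) has_real_derivative - f' (- t)) (at t)"
  proof eventually_elim
    case (elim t)
    from DERIV_mirror[THEN iffD1, OF elim] show ?case by simp
  qed
  moreover have "((\<lambda>t. - f' (- t)) has_real_derivative s) (at 0)"
  proof -
    have "(f' has_real_derivative s) (at (- 0))" using f(2) by simp
    from DERIV_minus[OF DERIV_mirror[THEN iffD1, OF this]] show ?thesis by simp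
  qed
  ultimately show ?thesis
    unfolding has_second_deriv_along_def by (intro exI conjI)
qed

text \<open>\<open>T\<close> need only be affine along the line through \<open>x\<close> in direction \<open>b\<close>; it is used for
  translations and for reflections, which send a coordinate direction to plus or minus itself.\<close>

lemma has_second_deriv_along_affine:
  assumes "has_second_deriv_along f b' (T x) s" "\<And>t. T (x + t *\<^sub>R b) = T x + t *\<^sub>R b'"
  shows "has_second_deriv_along (\<lambda>y. f (T y)) b x s"
  using assms unfolding has_second_deriv_along_def by simp

lemma has_second_deriv_along_quadratic:
  assumes "\<And>t. f (x + t *\<^sub>R b) = A + B * t + C * t\<^sup>2"
  shows "has_second_deriv_along f b x (2 * C)"
proof -
  have "((\<lambda>t. f (x + t *\<^sub>R b)) has_real_derivative B + 2 * C * t) (at t)" for t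
    unfolding assms by (auto intro!: derivative_eq_intros)
  moreover have "((\<lambda>t. B + 2 * C * t) has_real_derivative 2 * C) (at 0)"
    by (auto intro!: derivative_eq_intros)
  ultimately show ?thesis
    unfolding has_second_deriv_along_def by (intro exI[of _ "\<lambda>t. B + 2 * C * t"]) simp
qed

text \<open>If the second derivative were positive, the first derivative, which vanishes at the maximum,
  would be positive just after it, and the function would increase there.\<close>

lemma has_second_deriv_along_local_max:
  assumes "has_second_deriv_along f b x s" "\<forall>\<^sub>F t in nhds 0. f (x + t *\<^sub>R b) \<le> f x"
  shows "s \<le> 0"
proof (rule ccontr)
  assume "\<not> s \<le> 0"
  obtain g where g: "\<forall>\<^sub>F t in nhds 0. ((\<lambda>t. f (x + t *\<^sub>R b)) has_real_derivative g t) (at t)"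
      "(g has_real_derivative s) (at 0)"
    using assms(1) unfolding has_second_deriv_along_def by blast
  from eventually_conj[OF g(1) assms(2)] obtain e where e: "e > 0"
    "\<And>t. \<bar>t\<bar> < e \<Longrightarrow> ((\<lambda>t. f (x + t *\<^sub>R b)) has_real_derivative g t) (at t)"
    "\<And>t. \<bar>t\<bar> < e \<Longrightarrow> f (x + t *\<^sub>R b) \<le> f x"
    unfolding eventually_nhds_metric by (auto simp: dist_real_def)
  have g0: "g 0 = 0"
    by (rule DERIV_local_max[OF e(2)[of 0] e(1)]) (use e in auto)
  obtain d where d: "d > 0" "\<And>h. h > 0 \<Longrightarrow> h < d \<Longrightarrow> g 0 < g (0 + h)"
    using DERIV_pos_inc_right[OF g(2)] \<open>\<not> s \<le> 0\<close> by auto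
  define h where "h = min d e / 2"
  have h: "0 < h" "h < d" "h < e" using d e by (auto simp: h_def)
  have "f (x + 0 *\<^sub>R b) < f (x + h *\<^sub>R b)"
  proof (rule DERIV_pos_imp_increasing_open[OF h(1)])
    fix t assume "0 < t" "t < h"
    thus "\<exists>y. ((\<lambda>t. f (x + t *\<^sub>R b)) has_real_derivative y) (at t) \<and> 0 < y"
      using e(2)[of t] d(2)[of t] g0 h by (intro exI[of _ "g t"]) auto
  next
    show "continuous_on {0..h} (\<lambda>t. f (x + t *\<^sub>R b))"
      using e(2) h by (intro DERIV_atLeastAtMost_imp_continuous_on) force
  qed
  with e(3)[of h] h show False by simp
qed

lemma has_laplacian_add:
  assumes "has_laplacian f x l" "has_laplacian g x m"
  shows "has_laplacian (\<lambda>y. f y + g y) x (l + m)"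
proof -
  obtain s where s: "\<forall>b\<in>Basis. has_second_deriv_along f b x (s b)" "(\<Sum>b\<in>Basis. s b) = l"
    using assms(1) unfolding has_laplacian_def by blast
  obtain t where t: "\<forall>b\<in>Basis. has_second_deriv_along g b x (t b)" "(\<Sum>b\<in>Basis. t b) = m"
    using assms(2) unfolding has_laplacian_def by blast
  show ?thesis
    unfolding has_laplacian_def
    by (rule exI[of _ "\<lambda>b. s b + t b"]) (use s t in \<open>auto simp: sum.distrib intro: has_second_deriv_along_add\<close>)
qed

lemma has_laplacian_cmult:
  assumes "has_laplacian f x l"
  shows "has_laplacian (\<lambda>y. k * f y) x (k * l)"
proof -
  obtain s where s: "\<forall>b\<in>Basis. has_second_deriv_along f b x (s b)" "(\<Sum>b\<in>Basis. s b) = l"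
    using assms(1) unfolding has_laplacian_def by blast
  show ?thesis
    unfolding has_laplacian_def
    by (rule exI[of _ "\<lambda>b. k * s b"])
       (use s in \<open>auto simp: sum_distrib_left intro: has_second_deriv_along_cmult\<close>)
qed

lemma has_laplacian_diff:
  assumes "has_laplacian f x l" "has_laplacian g x m"
  shows "has_laplacian (\<lambda>y. f y - g y) x (l - m)"
  using has_laplacian_add[OF assms(1) has_laplacian_cmult[OF assms(2), of "-1"]] by simp

lemma has_laplacian_translate:
  assumes "has_laplacian f (x + a) l"
  shows "has_laplacian (\<lambda>y. f (y + a)) x l"
proof -
  obtain s where s: "\<forall>b\<in>Basis. has_second_deriv_along f b (x + a) (s b)" "(\<Sum>b\<in>Basis. s b) = l"
    using assms unfolding has_laplacian_def by blast
  have "has_second_deriv_along (\<lambda>y. f (y + a)) b x (s b)" if "b \<in> Basis" for b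
    by (rule has_second_deriv_along_affine[of f b]) (use s that in \<open>auto simp: algebra_simps\<close>)
  with s show ?thesis unfolding has_laplacian_def by blast
qed

text \<open>The reflection in the hyperplane through \<open>x\<close> orthogonal to the unit vector \<open>b\<close>.\<close>

definition reflect :: "'a::euclidean_space \<Rightarrow> 'a \<Rightarrow> 'a \<Rightarrow> 'a" where
  "reflect x b y = y - (2 * ((y - x) \<bullet> b)) *\<^sub>R b"

lemma reflect_add:
  assumes "b \<in> Basis" "c \<in> Basis"
  shows "reflect x b (y + t *\<^sub>R c) = reflect x b y + t *\<^sub>R (if c = b then - c else c)"
proof -
  have "(y + t *\<^sub>R c - x) \<bullet> b = (y - x) \<bullet> b + (if c = b then t else 0)"
    using assms by (simp add: inner_Basis inner_simps)
  moreover have "(2 * (p + t)) *\<^sub>R b = (2 * p) *\<^sub>R b + t *\<^sub>R b + t *\<^sub>R b" for p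
    by (simp flip: scaleR_add_left)
  ultimately show ?thesis
    unfolding reflect_def by simp
qed

lemma dist_reflect:
  assumes "b \<in> Basis"
  shows "dist x (reflect x b y) = dist x y"
proof -
  define z where "z = y - x"
  have "(norm (z - (2 * (z \<bullet> b)) *\<^sub>R b))\<^sup>2 = (norm z)\<^sup>2"
    using assms
    by (simp add: power2_norm_eq_inner algebra_simps inner_commute)
  hence "norm (z - (2 * (z \<bullet> b)) *\<^sub>R b) = norm z" by simp
  moreover have "reflect x b y - x = z - (2 * (z \<bullet> b)) *\<^sub>R b"
    by (simp add: reflect_def z_def algebra_simps)
  ultimately have "norm (reflect x b y - x) = norm z" by metis
  thus ?thesis
    by (simp add: dist_norm norm_minus_commute[of x] z_def)
qed

lemma has_laplacian_reflect:
  assumes "b \<in> Basis" "has_laplacian f (reflect x b y) l"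
  shows "has_laplacian (\<lambda>y. f (reflect x b y)) y l"
proof -
  obtain s where s: "\<forall>c\<in>Basis. has_second_deriv_along f c (reflect x b y) (s c)"
      "(\<Sum>c\<in>Basis. s c) = l"
    using assms(2) unfolding has_laplacian_def by blast
  have "has_second_deriv_along (\<lambda>y. f (reflect x b y)) c y (s c)" if c: "c \<in> Basis" for c
  proof (rule has_second_deriv_along_affine[OF _ reflect_add[OF assms(1) c]])
    have "has_second_deriv_along f c (reflect x b y) (s c)" using s c by blast
    thus "has_second_deriv_along f (if c = b then - c else c) (reflect x b y) (s c)"
      using has_second_deriv_along_minus_direction by auto
  qed
  with s show ?thesis unfolding has_laplacian_def by blast
qed

lemma has_laplacian_norm_sq:
  fixes x :: "'a::euclidean_space"
  shows "has_laplacian (\<lambda>y. (norm (y - x))\<^sup>2) y (2 * real DIM('a))"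
proof -
  have "has_second_deriv_along (\<lambda>y. (norm (y - x))\<^sup>2) c y (2 * 1)" if "c \<in> Basis" for c
  proof (rule has_second_deriv_along_quadratic)
    fix t
    show "(norm (y + t *\<^sub>R c - x))\<^sup>2 = (norm (y - x))\<^sup>2 + (2 * ((y - x) \<bullet> c)) * t + 1 * t\<^sup>2"
      using that unfolding power2_norm_eq_inner
      by (simp add: algebra_simps inner_commute power2_eq_square)
  qed
  thus ?thesis
    unfolding has_laplacian_def by (intro exI[of _ "\<lambda>_. 2 * 1"]) simp
qed

lemma has_laplacian_coordinate_quadratic:
  fixes x :: "'a::euclidean_space"
  assumes "b \<in> Basis"
  shows "has_laplacian (\<lambda>y. \<rho> * ((y - x) \<bullet> b) - ((y - x) \<bullet> b)\<^sup>2) y (- 2)"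
proof -
  have "has_second_deriv_along (\<lambda>y. \<rho> * ((y - x) \<bullet> b) - ((y - x) \<bullet> b)\<^sup>2) c y
          (2 * (if c = b then - 1 else 0))" if "c \<in> Basis" for c
    by (rule has_second_deriv_along_quadratic
          [where A = "\<rho> * ((y - x) \<bullet> b) - ((y - x) \<bullet> b)\<^sup>2"
             and B = "if c = b then \<rho> - 2 * ((y - x) \<bullet> b) else 0"])
       (use that assms in \<open>auto simp: inner_Basis algebra_simps power2_eq_square\<close>)
  thus ?thesis
    unfolding has_laplacian_def
    by (intro exI[of _ "\<lambda>c. 2 * (if c = b then - 1 else 0)"])
       (use assms in \<open>auto simp: sum_distrib_left[symmetric]\<close>)
qed

lemma has_laplacian_local_max:
  assumes "has_laplacian f x l" "\<forall>\<^sub>F y in nhds x. f y \<le> f x"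
  shows "l \<le> 0"
proof -
  obtain s where s: "\<forall>b\<in>Basis. has_second_deriv_along f b x (s b)" "(\<Sum>b\<in>Basis. s b) = l"
    using assms(1) unfolding has_laplacian_def by blast
  have "s b \<le> 0" if "b \<in> Basis" for b
  proof (rule has_second_deriv_along_local_max)
    show "has_second_deriv_along f b x (s b)" using s that by blast
    have "((\<lambda>t. x + t *\<^sub>R b) \<longlongrightarrow> x + 0 *\<^sub>R b) (nhds 0)"
      by (intro tendsto_intros filterlim_ident)
    hence "((\<lambda>t. x + t *\<^sub>R b) \<longlongrightarrow> x) (nhds 0)" by simp
    from eventually_compose_filterlim[OF assms(2) this]
    show "\<forall>\<^sub>F t in nhds 0. f (x + t *\<^sub>R b) \<le> f x" .
  qed
  thus ?thesis using s(2) sum_nonpos by metis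
qed

section \<open>The weak maximum principle and the interior gradient estimate\<close>

text \<open>Adding a small multiple of $|y - x|^2$ makes the Laplacian strictly positive, which excludes
  an interior maximum. Requiring the points where \<open>w\<close> is positive to
  be interior is the boundary condition in a form that makes no mention of the frontier of \<open>K\<close>.\<close>

lemma weak_maximum_principle:
  fixes w :: "'a::euclidean_space \<Rightarrow> real"
  assumes "compact K" "continuous_on K w"
    and sub: "\<And>y. y \<in> K \<Longrightarrow> w y > 0 \<Longrightarrow> y \<in> interior K \<and> (\<exists>l\<ge>0. has_laplacian w y l)"
    and "x \<in> K"
  shows "w x \<le> 0"
proof (rule ccontr)
  assume "\<not> w x \<le> 0"
  obtain R where R: "R > 0" "\<And>y. y \<in> K \<Longrightarrow> norm (y - x) \<le> R"
  proof -
    have "bounded ((\<lambda>y. y - x) ` K)"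
      using compact_imp_bounded[OF assms(1)] bounded_translation_minus by blast
    thus ?thesis using that unfolding bounded_pos by auto
  qed
  \<comment> \<open>small enough for the perturbation to change \<open>w\<close> on \<open>K\<close> by at most half of \<open>w x\<close>\<close>
  define e where "e = w x / (2 * R\<^sup>2)"
  have e: "e > 0" using R \<open>\<not> w x \<le> 0\<close> by (simp add: e_def)
  define v where "v = (\<lambda>y. w y + e * (norm (y - x))\<^sup>2)"
  have "continuous_on K v"
    unfolding v_def by (intro continuous_intros assms(2))
  then obtain y where y: "y \<in> K" "\<And>z. z \<in> K \<Longrightarrow> v z \<le> v y"
    using continuous_attains_sup[OF assms(1)] assms(4) by blast
  have "e * (norm (y - x))\<^sup>2 \<le> e * R\<^sup>2"
    using R y e by (intro mult_left_mono power_mono) auto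
  also have "\<dots> = w x / 2" using R by (simp add: e_def)
  finally have "w y > 0"
    using y(2)[OF assms(4)] \<open>\<not> w x \<le> 0\<close> by (simp add: v_def)
  from sub[OF y(1) this] obtain l where l: "y \<in> interior K" "l \<ge> 0" "has_laplacian w y l"
    by blast
  have "has_laplacian v y (l + e * (2 * real DIM('a)))"
    unfolding v_def by (intro has_laplacian_add has_laplacian_cmult has_laplacian_norm_sq l)
  moreover have "\<forall>\<^sub>F z in nhds y. v z \<le> v y"
    using eventually_nhds_in_open[OF open_interior l(1)]
    by eventually_elim (use y(2) interior_subset in blast)
  ultimately have "l + e * (2 * real DIM('a)) \<le> 0"
    by (rule has_laplacian_local_max)
  moreover have "e * (2 * real DIM('a)) > 0" using e by simp
  ultimately show False using l(2) by linarith
qed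

text \<open>The difference \<open>v\<close> of \<open>u\<close> and its mirror image vanishes on the flat face of the half ball
  \<open>K\<close> and is at most \<open>2 * M\<close> on the round part. With $z = y - x$ and $z_b = z \<bullet> b$ the polynomial
  \<open>\<phi>\<close> is $|z|^2 + N (\<rho> z_b - z_b^2)$. It is harmonic, as the two summands have Laplacians $2N$
  and $-2N$, and for $0 \<le> z_b \<le> \<rho>$ it is at least $|z|^2$. Hence $(2M/\<rho>^2)\,\<phi>$ dominates
  \<open>v\<close> on the boundary of \<open>K\<close>, therefore on \<open>K\<close>, and it grows at most linearly along the axis
  $z = t b$.\<close>

lemma harmonic_symmetric_difference_bound:
  fixes u :: "'a::euclidean_space \<Rightarrow> real" and M \<rho> :: real
  assumes "b \<in> Basis" "0 < \<rho>"
    and cont: "continuous_on (cball x \<rho>) u"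
    and harm: "\<And>y. y \<in> cball x \<rho> \<Longrightarrow> has_laplacian u y 0"
    and bound: "\<And>y. y \<in> cball x \<rho> \<Longrightarrow> \<bar>u y\<bar> \<le> M"
    and t: "0 \<le> t" "t \<le> \<rho>"
  shows "u (x + t *\<^sub>R b) - u (x - t *\<^sub>R b) \<le> 2 * M * DIM('a) * t / \<rho>"
proof -
  define N where "N = real DIM('a)"
  define \<phi> where
    "\<phi> = (\<lambda>y. (norm (y - x))\<^sup>2 + N * (\<rho> * ((y - x) \<bullet> b) - ((y - x) \<bullet> b)\<^sup>2))"
  define k where "k = 2 * M / \<rho>\<^sup>2"
  define v where "v = (\<lambda>y. u y - u (reflect x b y))"
  define K where "K = cball x \<rho> \<inter> {y. (y - x) \<bullet> b \<ge> 0}"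
  have M: "M \<ge> 0" using bound[of x] assms(2) by auto
  hence k: "k \<ge> 0" by (simp add: k_def)
  have refl: "reflect x b y \<in> cball x \<rho>" if "y \<in> cball x \<rho>" for y
    using that assms(1) by (simp add: dist_reflect)
  have contr: "continuous_on A (reflect x b)" for A
    unfolding reflect_def by (intro continuous_intros)
  have contv: "continuous_on (cball x \<rho>) v"
    unfolding v_def
    by (intro continuous_intros cont continuous_on_compose2[OF cont contr]) (use refl in auto)
  have closed: "closed {y. (y - x) \<bullet> b \<ge> 0}"
    by (intro closed_Collect_le continuous_intros)
  have height: "(y - x) \<bullet> b \<le> \<rho>" if "y \<in> K" for y
    using that Basis_le_norm[OF assms(1), of "y - x"]
    by (auto simp: K_def dist_norm norm_minus_commute)
  have bary: "N * (\<rho> * ((y - x) \<bullet> b) - ((y - x) \<bullet> b)\<^sup>2) \<ge> 0" if "y \<in> K" for y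
  proof -
    have "((y - x) \<bullet> b)\<^sup>2 \<le> \<rho> * ((y - x) \<bullet> b)"
      unfolding power2_eq_square
      using that height[OF that] by (intro mult_right_mono) (auto simp: K_def)
    thus ?thesis by (simp add: N_def)
  qed
  have max: "v y - k * \<phi> y \<le> 0" if "y \<in> K" for y
  proof (rule weak_maximum_principle[OF _ _ _ that])
    show "compact K"
      unfolding K_def by (rule compact_Int_closed[OF compact_cball closed])
    show "continuous_on K (\<lambda>y. v y - k * \<phi> y)"
      unfolding \<phi>_def
      by (intro continuous_intros continuous_on_subset[OF contv]) (auto simp: K_def)
  next
    fix y assume y: "y \<in> K" "v y - k * \<phi> y > 0"
    have phi: "\<phi> y \<ge> (norm (y - x))\<^sup>2" using bary[OF y(1)] by (simp add: \<phi>_def)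
    have "norm (y - x) \<noteq> \<rho>"
    proof
      assume "norm (y - x) = \<rho>"
      hence "k * \<phi> y \<ge> k * \<rho>\<^sup>2" using phi k by (intro mult_left_mono) auto
      also have "k * \<rho>\<^sup>2 = 2 * M" using assms(2) by (simp add: k_def)
      finally have "v y > 2 * M" using y by simp
      moreover have "\<bar>u y\<bar> \<le> M" "\<bar>u (reflect x b y)\<bar> \<le> M"
        using y(1) refl bound by (auto simp: K_def)
      ultimately show False by (simp add: v_def)
    qed
    moreover have "(y - x) \<bullet> b \<noteq> 0"
    proof
      assume "(y - x) \<bullet> b = 0"
      hence "v y = 0" by (simp add: v_def reflect_def)
      moreover have "k * \<phi> y \<ge> 0"
        using k phi by (intro mult_nonneg_nonneg) (auto intro: order_trans[OF zero_le_power2])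
      ultimately show False using y by simp
    qed
    ultimately have "y \<in> ball x \<rho> \<inter> {y. (y - x) \<bullet> b > 0}"
      using y(1) by (auto simp: K_def dist_norm norm_minus_commute)
    moreover have "open (ball x \<rho> \<inter> {y. (y - x) \<bullet> b > 0})"
      by (intro open_Int open_ball open_Collect_less continuous_intros)
    moreover have "ball x \<rho> \<inter> {y. (y - x) \<bullet> b > 0} \<subseteq> K" by (auto simp: K_def)
    ultimately have "y \<in> interior K" by (blast intro: interiorI)
    moreover have "has_laplacian (\<lambda>y. v y - k * \<phi> y) y
        ((0 - 0) - k * (2 * real DIM('a) + N * (- 2)))"
      unfolding v_def \<phi>_def
      by (intro has_laplacian_diff has_laplacian_cmult has_laplacian_add has_laplacian_norm_sq
            has_laplacian_coordinate_quadratic has_laplacian_reflect assms(1) harm)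
         (use y(1) refl in \<open>auto simp: K_def\<close>)
    hence "has_laplacian (\<lambda>y. v y - k * \<phi> y) y 0" by (simp add: N_def)
    ultimately show "y \<in> interior K \<and> (\<exists>l\<ge>0. has_laplacian (\<lambda>y. v y - k * \<phi> y) y l)"
      by blast
  qed
  define y where "y = x + t *\<^sub>R b"
  have yb: "(y - x) \<bullet> b = t" using assms(1) by (simp add: y_def)
  have "y \<in> K" using t assms(1) yb by (simp add: K_def) (simp add: y_def dist_norm)
  have "reflect x b y = x - t *\<^sub>R b"
    unfolding reflect_def yb by (simp add: y_def algebra_simps flip: scaleR_add_left)
  hence "v y = u (x + t *\<^sub>R b) - u (x - t *\<^sub>R b)"
    by (simp add: v_def y_def)
  moreover have "\<phi> y \<le> N * \<rho> * t"
  proof -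
    have "\<phi> y = t\<^sup>2 + N * (\<rho> * t - t\<^sup>2)"
      unfolding \<phi>_def yb using assms(1) by (simp add: y_def)
    moreover have "N \<ge> 1" by (simp add: N_def Suc_leI)
    hence "1 * t\<^sup>2 \<le> N * t\<^sup>2" by (intro mult_right_mono) auto
    ultimately show ?thesis by (simp add: algebra_simps)
  qed
  hence "k * \<phi> y \<le> k * (N * \<rho> * t)" using k by (rule mult_left_mono)
  moreover have "k * (N * \<rho> * t) = 2 * M * DIM('a) * t / \<rho>"
    using assms(2) by (simp add: k_def N_def power2_eq_square)
  ultimately show ?thesis using max[OF \<open>y \<in> K\<close>] by linarith
qed

text \<open>Dividing the bound on the symmetric difference $u(x + tb) - u(x - tb)$ by $t$ and letting
  $t \<rightarrow> 0$ bounds twice the derivative; applied to $u$ and to $-u$ this bounds its absolute value.\<close>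

lemma interior_gradient_estimate:
  fixes u :: "'a::euclidean_space \<Rightarrow> real" and M \<rho> :: real
  assumes "b \<in> Basis" "0 < \<rho>"
    and cont: "continuous_on (cball x \<rho>) u"
    and harm: "\<And>y. y \<in> cball x \<rho> \<Longrightarrow> has_laplacian u y 0"
    and bound: "\<And>y. y \<in> cball x \<rho> \<Longrightarrow> \<bar>u y\<bar> \<le> M"
    and D: "((\<lambda>t. u (x + t *\<^sub>R b)) has_real_derivative D) (at 0)"
  shows "\<bar>D\<bar> \<le> DIM('a) * M / \<rho>"
proof -
  have one_sided: "D \<le> DIM('a) * M / \<rho>"
    if cont: "continuous_on (cball x \<rho>) u"
    and harm: "\<And>y. y \<in> cball x \<rho> \<Longrightarrow> has_laplacian u y 0"
    and bound: "\<And>y. y \<in> cball x \<rho> \<Longrightarrow> \<bar>u y\<bar> \<le> M"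
    and D: "((\<lambda>t. u (x + t *\<^sub>R b)) has_real_derivative D) (at 0)" for u :: "'a \<Rightarrow> real" and D :: real
  proof (rule ccontr)
    assume less: "\<not> D \<le> DIM('a) * M / \<rho>"
    \<comment> \<open>if \<open>D\<close> were too large, the symmetric difference would exceed \<open>q * h\<close> for small \<open>h > 0\<close>\<close>
    define q where "q = 2 * (DIM('a) * M / \<rho>)"
    have D': "((\<lambda>t. u (x + (- t) *\<^sub>R b)) has_real_derivative - D) (at 0)"
    proof -
      have "((\<lambda>t. u (x + t *\<^sub>R b)) has_real_derivative D) (at (- 0))" using D by simp
      from DERIV_mirror[THEN iffD1, OF this] show ?thesis .
    qed
    have "((\<lambda>t. u (x + t *\<^sub>R b) - u (x + (- t) *\<^sub>R b) - q * t) has_real_derivative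
        D - (- D) - q * 1) (at 0)"
      by (intro DERIV_diff DERIV_cmult DERIV_ident D D')
    moreover have "D - (- D) - q * 1 > 0" using less unfolding q_def by linarith
    ultimately obtain d where d: "d > 0" "\<And>h. 0 < h \<Longrightarrow> h < d \<Longrightarrow>
        0 < u (x + h *\<^sub>R b) - u (x - h *\<^sub>R b) - q * h"
      by (drule_tac DERIV_pos_inc_right) auto
    define h where "h = min d \<rho> / 2"
    have "0 < h" "h < d" "h \<le> \<rho>" using d(1) assms(2) by (auto simp: h_def)
    with d(2)[of h]
      harmonic_symmetric_difference_bound[OF assms(1,2) cont harm bound, of h]
    show False by (simp add: q_def mult_ac)
  qed
  have "D \<le> DIM('a) * M / \<rho>" by (rule one_sided[OF cont harm bound D])
  moreover have "- D \<le> DIM('a) * M / \<rho>"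
  proof (rule one_sided)
    show "continuous_on (cball x \<rho>) (\<lambda>y. - u y)" by (intro continuous_intros cont)
    show "has_laplacian (\<lambda>y. - u y) y 0" if "y \<in> cball x \<rho>" for y
      using has_laplacian_cmult[OF harm[OF that], of "-1"] by simp
    show "\<bar>- u y\<bar> \<le> M" if "y \<in> cball x \<rho>" for y using bound[OF that] by simp
    show "((\<lambda>t. - u (x + t *\<^sub>R b)) has_real_derivative - D) (at 0)" by (intro DERIV_minus D)
  qed
  ultimately show ?thesis by (simp add: abs_le_iff)
qed

section \<open>Harmonic functions on open sets\<close>

text \<open>\<^const>\<open>partial_deriv\<close> differentiates at the parameter $0$ of the line based at the point itself;
  rebasing the line at \<open>x\<close> turns it into the derivative at the parameter \<open>t\<close>.\<close>

lemma partial_deriv_has_real_derivative: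
  assumes "f differentiable (at (x + t *\<^sub>R b))"
  shows "((\<lambda>t. f (x + t *\<^sub>R b)) has_real_derivative partial_deriv b f (x + t *\<^sub>R b)) (at t)"
proof -
  have "((\<lambda>s. (x + t *\<^sub>R b) + s *\<^sub>R b) has_derivative (\<lambda>s. s *\<^sub>R b)) (at 0)"
    by (auto intro!: derivative_eq_intros)
  hence "(\<lambda>s. (x + t *\<^sub>R b) + s *\<^sub>R b) differentiable (at 0)"
    unfolding differentiable_def by blast
  moreover have "f differentiable (at ((x + t *\<^sub>R b) + 0 *\<^sub>R b))" using assms by simp
  ultimately have "(\<lambda>s. f ((x + t *\<^sub>R b) + s *\<^sub>R b)) differentiable (at 0)"
    by (rule differentiable_compose[rotated])
  hence "((\<lambda>s. f ((x + t *\<^sub>R b) + s *\<^sub>R b)) has_real_derivative partial_deriv b f (x + t *\<^sub>R b)) (at 0)"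
    unfolding partial_deriv_def
    by (metis DERIV_imp_deriv real_differentiable_def)
  moreover have "(\<lambda>s. f ((x + t *\<^sub>R b) + s *\<^sub>R b)) = (\<lambda>s. f (x + (s + t) *\<^sub>R b))"
    by (simp add: algebra_simps)
  ultimately have "((\<lambda>s. f (x + (s + t) *\<^sub>R b)) has_real_derivative partial_deriv b f (x + t *\<^sub>R b)) (at 0)"
    by simp
  from DERIV_at_within_shift[of "\<lambda>t. f (x + t *\<^sub>R b)" _ t 0 UNIV] this
  show ?thesis by (simp add: add.commute)
qed

lemma has_derivative_grad:
  fixes f :: "'a::euclidean_space \<Rightarrow> real"
  assumes "f differentiable (at x)"
  shows "(f has_derivative (\<lambda>h. grad f x \<bullet> h)) (at x)"
proof -
  obtain f' where f': "(f has_derivative f') (at x)"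
    using assms unfolding differentiable_def by blast
  interpret linear f' using f' by (rule has_derivative_linear)
  have pd: "partial_deriv b f x = f' b" for b
  proof -
    have "((\<lambda>t. x + t *\<^sub>R b) has_derivative (\<lambda>t. t *\<^sub>R b)) (at 0)"
      by (auto intro!: derivative_eq_intros)
    moreover have "(f has_derivative f') (at (x + 0 *\<^sub>R b))" using f' by simp
    ultimately have "((\<lambda>t. f (x + t *\<^sub>R b)) has_derivative (\<lambda>t. f' (t *\<^sub>R b))) (at 0)"
      by (rule has_derivative_compose)
    hence "((\<lambda>t. f (x + t *\<^sub>R b)) has_real_derivative f' b) (at 0)"
      by (simp add: has_field_derivative_def scale mult.commute[of _ "f' b"] mult_commute_abs)
    thus ?thesis unfolding partial_deriv_def by (rule DERIV_imp_deriv)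
  qed
  have "f' h = grad f x \<bullet> h" for h
  proof -
    have "f' h = f' (\<Sum>b\<in>Basis. (h \<bullet> b) *\<^sub>R b)" by (simp add: euclidean_representation)
    also have "\<dots> = (\<Sum>b\<in>Basis. (h \<bullet> b) * f' b)" by (simp add: sum scale)
    also have "\<dots> = grad f x \<bullet> h"
      unfolding grad_def pd by (simp add: inner_sum_left inner_commute[of h] mult.commute)
    finally show ?thesis .
  qed
  hence "f' = (\<lambda>h. grad f x \<bullet> h)" by (rule ext)
  thus ?thesis using f' by metis
qed

lemma harmonic_on_has_laplacian:
  assumes "harmonic_on f S" "open S" "x \<in> S"
  shows "has_laplacian f x 0"
proof -
  have "has_second_deriv_along f b x (partial_deriv b (partial_deriv b f) x)" if b: "b \<in> Basis" for b
    unfolding has_second_deriv_along_def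
  proof (intro exI conjI)
    have "((\<lambda>t. x + t *\<^sub>R b) \<longlongrightarrow> x + 0 *\<^sub>R b) (nhds 0)"
      by (intro tendsto_intros filterlim_ident)
    hence "\<forall>\<^sub>F t in nhds 0. x + t *\<^sub>R b \<in> S"
      using assms(2,3) by (intro topological_tendstoD) auto
    thus "\<forall>\<^sub>F t in nhds 0. ((\<lambda>t. f (x + t *\<^sub>R b)) has_real_derivative
        partial_deriv b f (x + t *\<^sub>R b)) (at t)"
      by eventually_elim
        (use assms(1) in \<open>auto simp: harmonic_on_def C2_on_def intro!: partial_deriv_has_real_derivative\<close>)
    have "partial_deriv b f differentiable (at (x + 0 *\<^sub>R b))"
      using assms b by (simp add: harmonic_on_def C2_on_def)
    from partial_deriv_has_real_derivative[OF this]
    show "((\<lambda>t. partial_deriv b f (x + t *\<^sub>R b)) has_real_derivative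
        partial_deriv b (partial_deriv b f) x) (at 0)" by simp
  qed
  moreover have "(\<Sum>b\<in>Basis. partial_deriv b (partial_deriv b f) x) = 0"
    using assms by (simp add: harmonic_on_def laplacian_def)
  ultimately show ?thesis
    unfolding has_laplacian_def
    by (intro exI[of _ "\<lambda>b. partial_deriv b (partial_deriv b f) x"]) blast
qed

section \<open>The Lipschitz epigraph\<close>

text \<open>The height above the graph is used in place of the distance to the boundary: for a Lipschitz
  graph the two are comparable, and a vertical shift changes the height by exactly its length.\<close>

definition height :: "(real ^ 'm \<Rightarrow> real) \<Rightarrow> (real ^ 'm) \<times> real \<Rightarrow> real" where
  "height \<Psi> x = snd x - \<Psi> (fst x)"

lemma strict_epigraph_iff_height: "x \<in> strict_epigraph \<Psi> \<longleftrightarrow> 0 < height \<Psi> x"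
  by (cases x) (auto simp: strict_epigraph_def height_def)

lemma height_lift: "height \<Psi> (x + h *\<^sub>R (0, 1)) = height \<Psi> x + h"
  by (cases x) (simp add: height_def)

lemma height_lipschitz:
  fixes \<Psi> :: "real ^ 'm \<Rightarrow> real"
  assumes "\<forall>x y. \<bar>\<Psi> x - \<Psi> y\<bar> \<le> L * norm (x - y)"
  shows "\<bar>height \<Psi> x - height \<Psi> y\<bar> \<le> (1 + \<bar>L\<bar>) * norm (x - y)"
proof -
  have "norm (fst (x - y)) \<le> norm (x - y)" "norm (snd (x - y)) \<le> norm (x - y)"
    using norm_fst_le[of "fst (x - y)" "snd (x - y)"] norm_snd_le[of "snd (x - y)" "fst (x - y)"]
    by (simp_all only: prod.collapse)
  hence proj: "norm (fst x - fst y) \<le> norm (x - y)" "\<bar>snd x - snd y\<bar> \<le> norm (x - y)"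
    by simp_all
  have "\<bar>\<Psi> (fst x) - \<Psi> (fst y)\<bar> \<le> L * norm (fst x - fst y)" using assms by blast
  also have "\<dots> \<le> \<bar>L\<bar> * norm (fst x - fst y)" by (intro mult_right_mono) auto
  also have "\<dots> \<le> \<bar>L\<bar> * norm (x - y)" by (intro mult_left_mono proj) auto
  finally have "\<bar>\<Psi> (fst x) - \<Psi> (fst y)\<bar> + \<bar>snd x - snd y\<bar> \<le> (1 + \<bar>L\<bar>) * norm (x - y)"
    using proj(2) by (simp add: algebra_simps)
  thus ?thesis unfolding height_def by linarith
qed

lemma continuous_on_height:
  fixes \<Psi> :: "real ^ 'm \<Rightarrow> real"
  assumes "\<forall>x y. \<bar>\<Psi> x - \<Psi> y\<bar> \<le> L * norm (x - y)"
  shows "continuous_on S (height \<Psi>)"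
proof -
  have "(1 + \<bar>L\<bar>)-lipschitz_on S (height \<Psi>)"
    using height_lipschitz[OF assms] by (intro lipschitz_onI) (auto simp: dist_norm)
  thus ?thesis by (rule lipschitz_on_continuous_on)
qed

lemma open_strict_epigraph:
  fixes \<Psi> :: "real ^ 'm \<Rightarrow> real"
  assumes "\<forall>x y. \<bar>\<Psi> x - \<Psi> y\<bar> \<le> L * norm (x - y)"
  shows "open (strict_epigraph \<Psi>)"
proof -
  have "strict_epigraph \<Psi> = {x. 0 < height \<Psi> x}" by (auto simp: strict_epigraph_iff_height)
  thus ?thesis using continuous_on_height[OF assms]
    by (simp add: open_Collect_less continuous_on_const)
qed

lemma closed_epigraph_subset_closure:
  "closed_epigraph \<Psi> \<subseteq> closure (strict_epigraph \<Psi>)"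
proof (clarsimp simp: closed_epigraph_def closure_approachable)
  fix x' and t e :: real
  assume "\<Psi> x' \<le> t" "0 < e"
  thus "\<exists>y\<in>strict_epigraph \<Psi>. dist y (x', t) < e"
    by (intro bexI[of _ "(x', t + e / 2)"]) (auto simp: strict_epigraph_def dist_Pair_Pair dist_real_def)
qed

text \<open>The point of the graph below \<open>x\<close> is a boundary point at distance \<open>height \<Psi> x\<close>. Positivity of
  the distance is what makes its negative powers decreasing, because \<open>0 powr a\<close> is \<open>0\<close>.\<close>

lemma infdist_frontier_epigraph:
  fixes \<Psi> :: "real ^ 'm \<Rightarrow> real"
  assumes "\<forall>x y. \<bar>\<Psi> x - \<Psi> y\<bar> \<le> L * norm (x - y)" "x \<in> strict_epigraph \<Psi>"
  shows "0 < infdist x (frontier (strict_epigraph \<Psi>))"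
    and "infdist x (frontier (strict_epigraph \<Psi>)) \<le> height \<Psi> x"
proof -
  let ?E = "strict_epigraph \<Psi>"
  define p where "p = (fst x, \<Psi> (fst x))"
  have int: "interior ?E = ?E" using open_strict_epigraph[OF assms(1)] by (rule interior_open)
  have "p \<in> closed_epigraph \<Psi>" "p \<notin> ?E"
    by (auto simp: p_def closed_epigraph_def strict_epigraph_def)
  hence p: "p \<in> frontier ?E"
    using closed_epigraph_subset_closure int by (auto simp: frontier_def)
  have "x \<notin> frontier ?E" using assms(2) int by (simp add: frontier_def)
  thus "0 < infdist x (frontier ?E)"
    using p by (intro infdist_pos_not_in_closed frontier_closed) auto
  have "dist x p = height \<Psi> x"
    using assms(2) unfolding strict_epigraph_iff_height
    by (cases x) (simp add: p_def dist_Pair_Pair dist_real_def height_def)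
  thus "infdist x (frontier ?E) \<le> height \<Psi> x" using infdist_le[OF p, of x] by simp
qed

text \<open>As the height is Lipschitz with constant $1 + |L|$, it is still at least half of its value at
  \<open>x\<close> on the ball of radius \<open>\<rho>\<close> below, so the interior estimate applies on that ball.\<close>

lemma epigraph_gradient_estimate:
  fixes \<Psi> :: "real ^ 'm \<Rightarrow> real" and u :: "(real ^ 'm) \<times> real \<Rightarrow> real" and M :: real
  assumes lip: "\<forall>x y. \<bar>\<Psi> x - \<Psi> y\<bar> \<le> L * norm (x - y)"
    and cont: "continuous_on (strict_epigraph \<Psi>) u"
    and harm: "\<And>y. y \<in> strict_epigraph \<Psi> \<Longrightarrow> has_laplacian u y 0"
    and bound: "\<And>y. y \<in> strict_epigraph \<Psi> \<Longrightarrow> \<bar>u y\<bar> \<le> M"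
    and x: "x \<in> strict_epigraph \<Psi>" and b: "b \<in> Basis"
    and D: "((\<lambda>t. u (x + t *\<^sub>R b)) has_real_derivative D) (at 0)"
  shows "\<bar>D\<bar> \<le> 2 * (1 + \<bar>L\<bar>) * DIM((real ^ 'm) \<times> real) * M / height \<Psi> x"
proof -
  define \<rho> where "\<rho> = height \<Psi> x / (2 * (1 + \<bar>L\<bar>))"
  have h: "0 < height \<Psi> x" using x by (simp add: strict_epigraph_iff_height)
  have \<rho>: "0 < \<rho>" using h by (simp add: \<rho>_def)
  have sub: "cball x \<rho> \<subseteq> strict_epigraph \<Psi>"
  proof
    fix y assume "y \<in> cball x \<rho>"
    hence "(1 + \<bar>L\<bar>) * norm (x - y) \<le> (1 + \<bar>L\<bar>) * \<rho>"
      by (intro mult_left_mono) (auto simp: dist_norm)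
    also have "\<dots> = height \<Psi> x / 2" by (simp add: \<rho>_def field_simps add_eq_0_iff)
    finally have "\<bar>height \<Psi> x - height \<Psi> y\<bar> \<le> height \<Psi> x / 2"
      using height_lipschitz[OF lip, of x y] by linarith
    thus "y \<in> strict_epigraph \<Psi>" using h unfolding strict_epigraph_iff_height by linarith
  qed
  have "\<bar>D\<bar> \<le> DIM((real ^ 'm) \<times> real) * M / \<rho>"
    by (rule interior_gradient_estimate[OF b \<rho> continuous_on_subset[OF cont sub] _ _ D])
       (use sub harm bound in auto)
  also have "\<dots> = 2 * (1 + \<bar>L\<bar>) * DIM((real ^ 'm) \<times> real) * M / height \<Psi> x"
    by (simp add: \<rho>_def)
  finally show ?thesis .
qed

lemma telescoping_geometric_bound:
  fixes g :: "nat \<Rightarrow> real"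
  assumes q: "0 \<le> q" "q < 1" and B: "0 \<le> B"
    and step: "\<And>n. \<bar>g (Suc n) - g n\<bar> \<le> B * q ^ n" and lim: "g \<longlonglongrightarrow> 0"
  shows "\<bar>g 0\<bar> \<le> B / (1 - q)"
proof -
  have "\<bar>g 0\<bar> \<le> \<bar>g n\<bar> + B * (\<Sum>k<n. q ^ k)" for n
  proof (induction n)
    case (Suc n)
    have "\<bar>g n\<bar> \<le> \<bar>g (Suc n)\<bar> + B * q ^ n" using step[of n] by linarith
    with Suc.IH show ?case by (simp add: algebra_simps)
  qed simp
  moreover have "(\<Sum>k<n. q ^ k) \<le> 1 / (1 - q)" for n
    using q by (simp add: sum_gp_strict divide_right_mono)
  hence "B * (\<Sum>k<n. q ^ k) \<le> B * (1 / (1 - q))" for n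
    using B by (intro mult_left_mono)
  ultimately have "\<bar>g 0\<bar> \<le> \<bar>g n\<bar> + B * (1 / (1 - q))" for n
    by (meson add_left_mono order_trans)
  hence "\<bar>g 0\<bar> - B / (1 - q) \<le> \<bar>g n\<bar>" for n
    by (simp add: diff_le_eq)
  moreover have "(\<lambda>n. \<bar>g n\<bar>) \<longlonglongrightarrow> 0" using lim by (rule tendsto_rabs_zero)
  ultimately have "\<bar>g 0\<bar> - B / (1 - q) \<le> 0" by (intro LIMSEQ_le_const) auto
  thus ?thesis by simp
qed

text \<open>The points $X_n = x + (2^n - 1)\,\<delta>\,e_N$, with \<open>\<delta>\<close> the height of \<open>x\<close>, have height
  $2^n \<delta>$, and $X_{n+1}$ lies exactly that far above $X_n$. The gradient estimate for the vertical
  difference of \<open>U\<close> with this step bounds the change of the partial derivative by a multiple of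
  $C (2^n \<delta>)^{\<alpha>-1}$. Boundedness of \<open>U\<close> enters only to show that the partial derivative tends
  to $0$ along $X_n$, so the bound on \<open>U\<close> does not appear in the result.\<close>

lemma partial_deriv_bound_from_vertical_holder:
  fixes \<Psi> :: "real ^ 'm \<Rightarrow> real" and U :: "(real ^ 'm) \<times> real \<Rightarrow> real"
  assumes \<alpha>: "\<alpha> < 1"
    and lip: "\<forall>x y. \<bar>\<Psi> x - \<Psi> y\<bar> \<le> L * norm (x - y)"
    and harm: "harmonic_on U (strict_epigraph \<Psi>)"
    and bdd: "bounded (U ` strict_epigraph \<Psi>)"
    and vert: "\<And>y h. y \<in> strict_epigraph \<Psi> \<Longrightarrow> 0 \<le> h \<Longrightarrow>
                 \<bar>U (y + h *\<^sub>R (0, 1)) - U y\<bar> \<le> C * h powr \<alpha>"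
    and C: "0 \<le> C" and x: "x \<in> strict_epigraph \<Psi>" and b: "b \<in> Basis"
  shows "\<bar>partial_deriv b U x\<bar> \<le>
    2 * (1 + \<bar>L\<bar>) * DIM((real ^ 'm) \<times> real) / (1 - 2 powr (\<alpha> - 1)) * C * height \<Psi> x powr (\<alpha> - 1)"
proof -
  let ?E = "strict_epigraph \<Psi>"
  define e :: "(real ^ 'm) \<times> real" where "e = (0, 1)"
  define H where "H = 2 * (1 + \<bar>L\<bar>) * real (DIM((real ^ 'm) \<times> real))"
  define \<delta> where "\<delta> = height \<Psi> x"
  define q where "q = 2 powr (\<alpha> - 1)"
  define X where "X = (\<lambda>n. x + ((2 ^ n - 1) * \<delta>) *\<^sub>R e)"
  define g where "g = (\<lambda>n. partial_deriv b U (X n))"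
  obtain M where M: "\<And>y. y \<in> ?E \<Longrightarrow> \<bar>U y\<bar> \<le> M"
    using bdd unfolding bounded_iff by auto
  have \<delta>: "0 < \<delta>" using x by (simp add: \<delta>_def strict_epigraph_iff_height)
  have H: "0 \<le> H" by (simp add: H_def)
  have diff: "U differentiable (at y)" if "y \<in> ?E" for y
    using harm that by (simp add: harmonic_on_def C2_on_def)
  have cont: "continuous_on ?E U"
    using diff by (intro continuous_at_imp_continuous_on ballI differentiable_imp_continuous_within)
  have lapl: "has_laplacian U y 0" if "y \<in> ?E" for y
    using harmonic_on_has_laplacian[OF harm open_strict_epigraph[OF lip] that] .
  have lift: "y + h *\<^sub>R e \<in> ?E" if "y \<in> ?E" "0 \<le> h" for y h
    using that unfolding e_def strict_epigraph_iff_height height_lift by linarith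
  have deriv: "((\<lambda>t. U (y + t *\<^sub>R b)) has_real_derivative partial_deriv b U y) (at 0)"
    if "y \<in> ?E" for y
    using partial_deriv_has_real_derivative[of U y 0 b] diff[OF that] by simp
  have size: "\<bar>partial_deriv b U y\<bar> \<le> H * M / height \<Psi> y" if "y \<in> ?E" for y
    unfolding H_def
    by (rule epigraph_gradient_estimate[OF lip cont lapl M that b deriv[OF that]])
  have step: "\<bar>partial_deriv b U (y + h *\<^sub>R e) - partial_deriv b U y\<bar>
      \<le> H * (C * h powr \<alpha>) / height \<Psi> y" if y: "y \<in> ?E" and h: "0 \<le> h" for y h
    unfolding H_def
  proof (rule epigraph_gradient_estimate[OF lip _ _ _ y b])
    show "continuous_on ?E (\<lambda>z. U (z + h *\<^sub>R e) - U z)"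
      by (intro continuous_intros cont continuous_on_compose2[OF cont]) (use lift h in auto)
    show "has_laplacian (\<lambda>z. U (z + h *\<^sub>R e) - U z) z 0" if "z \<in> ?E" for z
      using has_laplacian_diff[OF has_laplacian_translate[OF lapl[OF lift[OF that h]]] lapl[OF that]]
      by simp
    show "\<bar>U (z + h *\<^sub>R e) - U z\<bar> \<le> C * h powr \<alpha>" if "z \<in> ?E" for z
      unfolding e_def by (rule vert[OF that h])
    have "(\<lambda>t. U (y + t *\<^sub>R b + h *\<^sub>R e)) = (\<lambda>t. U (y + h *\<^sub>R e + t *\<^sub>R b))"
      by (simp add: add.commute add.left_commute)
    thus "((\<lambda>t. U (y + t *\<^sub>R b + h *\<^sub>R e) - U (y + t *\<^sub>R b)) has_real_derivative
        partial_deriv b U (y + h *\<^sub>R e) - partial_deriv b U y) (at 0)"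
      using deriv[OF lift[OF y h]] deriv[OF y] by (simp add: DERIV_diff)
  qed
  have XE: "X n \<in> ?E" for n
    unfolding X_def by (rule lift[OF x]) (use \<delta> in simp)
  have hX: "height \<Psi> (X n) = 2 ^ n * \<delta>" for n
    unfolding X_def e_def height_lift \<delta>_def by (simp add: algebra_simps)
  have XSuc: "X (Suc n) = X n + (2 ^ n * \<delta>) *\<^sub>R e" for n
    by (simp add: X_def add.assoc flip: scaleR_add_left) (simp add: algebra_simps)
  have "\<bar>g 0\<bar> \<le> H * C * \<delta> powr (\<alpha> - 1) / (1 - q)"
  proof (rule telescoping_geometric_bound)
    show "0 \<le> q" "q < 1" using \<alpha> by (simp_all add: q_def powr_less_one)
    show "0 \<le> H * C * \<delta> powr (\<alpha> - 1)" using H C by simp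
    fix n
    have "\<bar>g (Suc n) - g n\<bar> \<le> H * (C * (2 ^ n * \<delta>) powr \<alpha>) / (2 ^ n * \<delta>)"
      unfolding g_def XSuc using step[OF XE, of "2 ^ n * \<delta>" n] \<delta> by (simp add: hX)
    also have "\<dots> = H * C * ((2 ^ n * \<delta>) powr (\<alpha> - 1))"
      using \<delta> by (simp add: powr_diff)
    also have "(2 ^ n * \<delta>) powr (\<alpha> - 1) = \<delta> powr (\<alpha> - 1) * q ^ n"
      using \<delta> by (simp add: powr_mult q_def powr_realpow[symmetric] powr_powr mult.commute)
    finally show "\<bar>g (Suc n) - g n\<bar> \<le> H * C * \<delta> powr (\<alpha> - 1) * q ^ n" by simp
  next
    show "g \<longlonglongrightarrow> 0"
    proof (rule Lim_null_comparison)
      show "\<forall>\<^sub>F n in sequentially. norm (g n) \<le> H * M / \<delta> * (1 / 2) ^ n"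
        using size[OF XE] by (simp add: g_def hX field_simps)
      show "(\<lambda>n. H * M / \<delta> * (1 / 2) ^ n) \<longlonglongrightarrow> 0"
        by (intro tendsto_mult_right_zero LIMSEQ_power_zero) simp
    qed
  qed
  moreover have "g 0 = partial_deriv b U x" by (simp add: g_def X_def)
  ultimately show ?thesis by (simp add: H_def q_def \<delta>_def)
qed

lemma norm_grad_le:
  fixes f :: "'a::euclidean_space \<Rightarrow> real" and G :: real
  assumes "\<And>b. b \<in> Basis \<Longrightarrow> \<bar>partial_deriv b f x\<bar> \<le> G"
  shows "norm (grad f x) \<le> DIM('a) * G"
proof -
  have "norm (grad f x) \<le> (\<Sum>b\<in>(Basis :: 'a set). G)"
    unfolding grad_def by (rule sum_norm_le) (use assms in simp)
  thus ?thesis by simp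
qed

lemma lipschitz_on_segment_from_grad:
  fixes f :: "'a::euclidean_space \<Rightarrow> real"
  assumes "\<And>z. z \<in> closed_segment x y \<Longrightarrow> f differentiable (at z)"
    and "\<And>z. z \<in> closed_segment x y \<Longrightarrow> norm (grad f z) \<le> G"
  shows "\<bar>f x - f y\<bar> \<le> G * norm (x - y)"
proof -
  have G: "0 \<le> G" using order_trans[OF norm_ge_zero assms(2)[of x]] by simp
  have "norm (f x - f y) \<le> G * norm (x - y)"
  proof (rule differentiable_bound[where S = "closed_segment x y"])
    fix z assume z: "z \<in> closed_segment x y"
    show "(f has_derivative (\<lambda>h. grad f z \<bullet> h)) (at z within closed_segment x y)"
      using has_derivative_grad[OF assms(1)[OF z]] by (rule has_derivative_at_withinI)
    show "onorm (\<lambda>h. grad f z \<bullet> h) \<le> G"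
    proof (rule onorm_bound[OF G])
      fix h
      have "norm (grad f z \<bullet> h) \<le> norm (grad f z) * norm h"
        using Cauchy_Schwarz_ineq2 by simp
      also have "\<dots> \<le> G * norm h" by (intro mult_right_mono assms(2) z) simp
      finally show "norm (grad f z \<bullet> h) \<le> G * norm h" .
    qed
  qed auto
  thus ?thesis by simp
qed

text \<open>Points close to the graph cannot be joined directly, since the gradient bound degenerates
  there. Raising both by \<open>h\<close>, a multiple of their distance \<open>r\<close>, costs only vertical increments
  and moves the joining segment to height at least \<open>r\<close>.\<close>

lemma holder_from_vertical_holder:
  fixes \<Psi> :: "real ^ 'm \<Rightarrow> real" and U :: "(real ^ 'm) \<times> real \<Rightarrow> real"
  assumes \<alpha>: "\<alpha> < 1"
    and lip: "\<forall>x y. \<bar>\<Psi> x - \<Psi> y\<bar> \<le> L * norm (x - y)"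
    and diff: "\<And>y. y \<in> strict_epigraph \<Psi> \<Longrightarrow> U differentiable (at y)"
    and vert: "\<And>y h. y \<in> strict_epigraph \<Psi> \<Longrightarrow> 0 \<le> h \<Longrightarrow>
                 \<bar>U (y + h *\<^sub>R (0, 1)) - U y\<bar> \<le> C * h powr \<alpha>"
    and grad: "\<And>y. y \<in> strict_epigraph \<Psi> \<Longrightarrow>
                 norm (grad U y) \<le> G * height \<Psi> y powr (\<alpha> - 1)"
    and G: "0 \<le> G" and xy: "x \<in> strict_epigraph \<Psi>" "y \<in> strict_epigraph \<Psi>"
  shows "\<bar>U x - U y\<bar> \<le> (2 * C * (2 * (1 + \<bar>L\<bar>)) powr \<alpha> + G) * norm (x - y) powr \<alpha>"
proof (cases "x = y")
  case False
  define e :: "(real ^ 'm) \<times> real" where "e = (0, 1)"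
  define K where "K = 1 + \<bar>L\<bar>"
  define r where "r = norm (x - y)"
  \<comment> \<open>the height may drop by \<open>K * r\<close> along the segment, so twice that amount is needed\<close>
  define h where "h = 2 * K * r"
  have r: "0 < r" using False by (simp add: r_def)
  have K: "1 \<le> K" by (simp add: K_def)
  have h: "0 \<le> h" using r K by (simp add: h_def)
  have "h powr \<alpha> = (2 * K) powr \<alpha> * r powr \<alpha>"
    using r K by (simp add: h_def powr_mult)
  hence vertical: "\<bar>U (z + h *\<^sub>R e) - U z\<bar> \<le> C * (2 * K) powr \<alpha> * r powr \<alpha>"
    if "z \<in> strict_epigraph \<Psi>" for z
    using vert[OF that h] by (simp add: e_def)
  have seg: "r \<le> height \<Psi> z" if z: "z \<in> closed_segment (x + h *\<^sub>R e) (y + h *\<^sub>R e)" for z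
  proof -
    have "norm ((x + h *\<^sub>R e) - z) \<le> r"
      using segment_bound1[OF z] by (simp add: r_def norm_minus_commute)
    hence "K * norm ((x + h *\<^sub>R e) - z) \<le> K * r" using K by (intro mult_left_mono) auto
    hence "height \<Psi> z \<ge> height \<Psi> (x + h *\<^sub>R e) - K * r"
      using height_lipschitz[OF lip, of "x + h *\<^sub>R e" z] by (simp add: K_def)
    moreover have "height \<Psi> (x + h *\<^sub>R e) = height \<Psi> x + 2 * (K * r)"
      unfolding e_def height_lift by (simp add: h_def)
    moreover have "height \<Psi> x > 0" using xy by (simp add: strict_epigraph_iff_height)
    moreover have "1 * r \<le> K * r" using K r by (intro mult_right_mono) auto
    ultimately show ?thesis by linarith
  qed
  have "\<bar>U (x + h *\<^sub>R e) - U (y + h *\<^sub>R e)\<bar>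
      \<le> G * r powr (\<alpha> - 1) * norm ((x + h *\<^sub>R e) - (y + h *\<^sub>R e))"
  proof (rule lipschitz_on_segment_from_grad)
    fix z assume z: "z \<in> closed_segment (x + h *\<^sub>R e) (y + h *\<^sub>R e)"
    have zE: "z \<in> strict_epigraph \<Psi>"
      using seg[OF z] r by (simp add: strict_epigraph_iff_height)
    thus "U differentiable (at z)" by (rule diff)
    have "height \<Psi> z powr (\<alpha> - 1) \<le> r powr (\<alpha> - 1)"
      using seg[OF z] r \<alpha> by (intro powr_mono2') auto
    thus "norm (grad U z) \<le> G * r powr (\<alpha> - 1)"
      using grad[OF zE] G by (meson mult_left_mono order_trans)
  qed
  also have "\<dots> = G * r powr \<alpha>"
    using r by (simp add: r_def[symmetric] powr_diff)
  finally have "\<bar>U x - U y\<bar> \<le> 2 * (C * (2 * K) powr \<alpha> * r powr \<alpha>) + G * r powr \<alpha>"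
    using vertical[OF xy(1)] vertical[OF xy(2)] by linarith
  thus ?thesis by (simp add: K_def r_def algebra_simps)
qed simp

lemma holder_imp_uniformly_continuous_on:
  fixes f :: "'a::real_normed_vector \<Rightarrow> real"
  assumes \<alpha>: "0 < \<alpha>" and "\<And>x y. x \<in> S \<Longrightarrow> y \<in> S \<Longrightarrow> \<bar>f x - f y\<bar> \<le> c * norm (x - y) powr \<alpha>"
  shows "uniformly_continuous_on S f"
  unfolding uniformly_continuous_on_def
proof (intro allI impI)
  fix e :: real assume e: "0 < e"
  define k where "k = \<bar>c\<bar> + 1"
  have k: "0 < k" by (simp add: k_def)
  define d where "d = (e / k) powr (1 / \<alpha>)"
  have "dist (f y) (f x) < e" if "x \<in> S" "y \<in> S" "dist y x < d" for x y
  proof -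
    have "\<bar>f y - f x\<bar> \<le> c * norm (y - x) powr \<alpha>" using assms(2) that by blast
    also have "\<dots> \<le> k * norm (y - x) powr \<alpha>" by (intro mult_right_mono) (auto simp: k_def)
    also have "norm (y - x) powr \<alpha> < d powr \<alpha>"
      using that \<alpha> by (intro powr_less_mono2) (auto simp: dist_norm)
    hence "k * norm (y - x) powr \<alpha> < k * d powr \<alpha>" using k by simp
    also have "k * d powr \<alpha> = e" using e k \<alpha> by (simp add: d_def powr_powr)
    finally show ?thesis by (simp add: dist_real_def)
  qed
  moreover have "0 < d" using e k by (simp add: d_def)
  ultimately show "\<exists>d>0. \<forall>x\<in>S. \<forall>y\<in>S. dist y x < d \<longrightarrow> dist (f y) (f x) < e" by blast
qed

theorem theorem1p1:
  fixes \<Psi> :: "real ^ 'm \<Rightarrow> real" and L \<alpha> :: real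
  assumes "0 < \<alpha>" "\<alpha> < 1"
    and "\<forall>x y. \<bar>\<Psi> x - \<Psi> y\<bar> \<le> L * norm (x - y)"
  shows "\<exists>c1 c2 c3 :: real.
    \<forall>(U :: (real ^ 'm) \<times> real \<Rightarrow> real) (C :: real).
      harmonic_on U (strict_epigraph \<Psi>) \<longrightarrow>
      bounded (U ` strict_epigraph \<Psi>) \<longrightarrow>
      (\<forall>x' s t. s > \<Psi> x' \<longrightarrow> t > \<Psi> x' \<longrightarrow>
         \<bar>U (x', s) - U (x', t)\<bar> \<le> C * \<bar>s - t\<bar> powr \<alpha>) \<longrightarrow>
      (\<forall>x\<in>strict_epigraph \<Psi>.
         \<bar>partial_deriv (0, 1) U x\<bar>
           \<le> c1 * C * infdist x (frontier (strict_epigraph \<Psi>)) powr (\<alpha> - 1)) \<and>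
      (\<forall>x\<in>strict_epigraph \<Psi>.
         norm (grad U x)
           \<le> c2 * C * infdist x (frontier (strict_epigraph \<Psi>)) powr (\<alpha> - 1)) \<and>
      (\<forall>x\<in>strict_epigraph \<Psi>. \<forall>y\<in>strict_epigraph \<Psi>.
         \<bar>U x - U y\<bar> \<le> c3 * C * norm (x - y) powr \<alpha>) \<and>
      (\<exists>V. continuous_on (closed_epigraph \<Psi>) V \<and>
           (\<forall>x\<in>strict_epigraph \<Psi>. V x = U x))"
proof -
  define \<kappa> where
    "\<kappa> = 2 * (1 + \<bar>L\<bar>) * real DIM((real ^ 'm) \<times> real) / (1 - 2 powr (\<alpha> - 1))"
  define N where "N = real DIM((real ^ 'm) \<times> real)"
  define c3 where "c3 = 2 * (2 * (1 + \<bar>L\<bar>)) powr \<alpha> + N * \<kappa>"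
  note lip = assms(3)
  have \<kappa>: "0 \<le> \<kappa>"
    using assms(2) by (simp add: \<kappa>_def powr_less_one less_imp_le)
  let ?E = "strict_epigraph \<Psi>"
  let ?dist = "\<lambda>x. infdist x (frontier ?E)"
  have "(\<forall>x\<in>?E. \<bar>partial_deriv (0, 1) U x\<bar> \<le> \<kappa> * C * ?dist x powr (\<alpha> - 1)) \<and>
      (\<forall>x\<in>?E. norm (grad U x) \<le> N * \<kappa> * C * ?dist x powr (\<alpha> - 1)) \<and>
      (\<forall>x\<in>?E. \<forall>y\<in>?E. \<bar>U x - U y\<bar> \<le> c3 * C * norm (x - y) powr \<alpha>) \<and>
      (\<exists>V. continuous_on (closed_epigraph \<Psi>) V \<and> (\<forall>x\<in>?E. V x = U x))"
    if harm: "harmonic_on U ?E" and bdd: "bounded (U ` ?E)"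
      and hold: "\<forall>x' s t. s > \<Psi> x' \<longrightarrow> t > \<Psi> x' \<longrightarrow>
         \<bar>U (x', s) - U (x', t)\<bar> \<le> C * \<bar>s - t\<bar> powr \<alpha>"
    for U :: "(real ^ 'm) \<times> real \<Rightarrow> real" and C :: real
  proof -
    \<comment> \<open>any two points on a vertical line show that \<open>C\<close> is nonnegative\<close>
    have "\<bar>U (0, \<Psi> 0 + 2) - U (0, \<Psi> 0 + 1)\<bar> \<le> C * \<bar>(\<Psi> 0 + 2) - (\<Psi> 0 + 1)\<bar> powr \<alpha>"
      using hold by (intro hold[rule_format]) auto
    hence C: "0 \<le> C" by simp
    have vert: "\<bar>U (y + h *\<^sub>R (0, 1)) - U y\<bar> \<le> C * h powr \<alpha>" if "y \<in> ?E" "0 \<le> h" for y h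
      using hold[rule_format, of "fst y" "snd y + h" "snd y"] that
      by (cases y) (simp add: strict_epigraph_def)
    have diff: "U differentiable (at y)" if "y \<in> ?E" for y
      using harm that by (simp add: harmonic_on_def C2_on_def)
    have partial: "\<bar>partial_deriv b U x\<bar> \<le> \<kappa> * C * height \<Psi> x powr (\<alpha> - 1)"
      if "x \<in> ?E" "b \<in> Basis" for x b
      unfolding \<kappa>_def
      by (rule partial_deriv_bound_from_vertical_holder[OF assms(2) lip harm bdd vert C that])
    have gradient: "norm (grad U x) \<le> N * \<kappa> * C * height \<Psi> x powr (\<alpha> - 1)" if "x \<in> ?E" for x
      using norm_grad_le[of U x, OF partial[OF that]] by (simp add: N_def mult.assoc)
    have height_dist: "height \<Psi> x powr (\<alpha> - 1) \<le> ?dist x powr (\<alpha> - 1)" if "x \<in> ?E" for x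
      using infdist_frontier_epigraph[OF lip that] assms(2) by (intro powr_mono2') auto
    have NC: "0 \<le> N * \<kappa> * C" "0 \<le> \<kappa> * C" using \<kappa> C by (simp_all add: N_def)
    have holder: "\<bar>U x - U y\<bar> \<le> c3 * C * norm (x - y) powr \<alpha>" if "x \<in> ?E" "y \<in> ?E" for x y
      using holder_from_vertical_holder[OF assms(2) lip diff vert gradient NC(1) that]
      by (simp add: c3_def algebra_simps)
    have "uniformly_continuous_on ?E U"
      using holder by (rule holder_imp_uniformly_continuous_on[OF assms(1)])
    then obtain V where V: "uniformly_continuous_on (closure ?E) V" "\<And>x. x \<in> ?E \<Longrightarrow> U x = V x"
      using uniformly_continuous_on_extension_on_closure by metis
    have "continuous_on (closed_epigraph \<Psi>) V"
      using continuous_on_subset[OF uniformly_continuous_imp_continuous[OF V(1)]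
        closed_epigraph_subset_closure] .
    moreover have "\<forall>x\<in>?E. V x = U x" using V(2) by simp
    moreover have "(0, 1) \<in> (Basis :: ((real ^ 'm) \<times> real) set)" by (simp add: Basis_prod_def)
    hence "\<bar>partial_deriv (0, 1) U x\<bar> \<le> \<kappa> * C * ?dist x powr (\<alpha> - 1)" if "x \<in> ?E" for x
      using order_trans[OF partial mult_left_mono[OF height_dist NC(2)]] that by blast
    moreover have "norm (grad U x) \<le> N * \<kappa> * C * ?dist x powr (\<alpha> - 1)" if "x \<in> ?E" for x
      using order_trans[OF gradient mult_left_mono[OF height_dist NC(1)]] that by blast
    ultimately show ?thesis using holder by blast
  qed
  thus ?thesis by blast
qed

end
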